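(* Let $X$ be a path-connected topological space and let $Y\subseteq X^{2}$ be a subspace. Then $\mathrm{TC}_{2,X}(Y)\le \mathrm{cat}_{X\times X}(Y)$.
   Context: For continuous maps $f,g : A\to B$, the homotopic distance $\mathrm{D}(f,g)$ is the least positive integer $r$ such that $A$ has an open cover $\{A_1,\dots,A_r\}$ with $f|_{A_i}\simeq g|_{A_i}$ (as maps $A_i\to B$) for every $i$ (and $\infty$ if no such $r$ exists). For $X$ path-connected and $Y\subseteq X^{2}$, $\mathrm{TC}_{2,X}(Y)=\mathrm{D}(p_1|_Y,p_2|_Y)$, where $p_1,p_2 : X\times X\to X$ are the projections. The relative Lusternik-Schnirelmann category is $\mathrm{cat}_{X\times X}(Y)=\mathrm{D}(i_Y,\ast)$, where $i_Y : Y\to X\times X$ is the inclusion and $\ast : Y\to X\times X$ is a constant map; i.e. the least number of open subsets of $Y$ that cover $Y$ and whose inclusions into $X\times X$ are null-homotopic. *)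

theory Defs
  imports "HOL-Analysis.Analysis"
begin

text \<open>
  Members of the cover may be empty, so that the distance is \<open>1\<close> for empty \<open>A\<close>; the infimum of
  the empty set in \<^typ>\<open>enat\<close> is \<open>\<infinity>\<close>.
\<close>

definition homotopic_distance ::
  "'a topology \<Rightarrow> 'b topology \<Rightarrow> ('a \<Rightarrow> 'b) \<Rightarrow> ('a \<Rightarrow> 'b) \<Rightarrow> enat" where
  "homotopic_distance A B f g =
     Inf {enat r | r. r > 0 \<and>
       (\<exists>U :: nat \<Rightarrow> 'a set.
          (\<forall>i\<in>{1..r}. openin A (U i)) \<and>
          (\<Union>i\<in>{1..r}. U i) = topspace A \<and>
          (\<forall>i\<in>{1..r}. homotopic_with (\<lambda>_. True) (subtopology A (U i)) B f g))}"

definition relative_TC2 :: "'a topology \<Rightarrow> ('a \<times> 'a) set \<Rightarrow> enat" where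
  "relative_TC2 X Y = homotopic_distance (subtopology (prod_topology X X) Y) X fst snd"

text \<open>
  The point \<open>c\<close> is the value of the constant map \<open>Y \<rightarrow> Z\<close>. For path-connected \<open>Z\<close> its choice
  does not matter: see \<open>relative_cat_nullhomotopic\<close> below.
\<close>

definition relative_cat :: "'a topology \<Rightarrow> 'a set \<Rightarrow> 'a \<Rightarrow> enat" where
  "relative_cat Z Y c = homotopic_distance (subtopology Z Y) Z (\<lambda>z. z) (\<lambda>_. c)"

lemma homotopic_with_const_iff_nullhomotopic:
  assumes "path_connected_space Z" "c \<in> topspace Z"
  shows "homotopic_with (\<lambda>_. True) S Z f (\<lambda>_. c) \<longleftrightarrow>
         (\<exists>b. homotopic_with (\<lambda>_. True) S Z f (\<lambda>_. b))"
proof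
  assume "\<exists>b. homotopic_with (\<lambda>_. True) S Z f (\<lambda>_. b)"
  then obtain b where b: "homotopic_with (\<lambda>_. True) S Z f (\<lambda>_. b)" by blast
  have "homotopic_with (\<lambda>_. True) S Z (\<lambda>_. b) (\<lambda>_. c)"
  proof (cases "S = trivial_topology")
    case False
    then have "b \<in> topspace Z"
      using homotopic_with_imp_continuous_maps[OF b] by simp
    then show ?thesis
      using assms by (simp add: homotopic_constant_maps path_connected_space_iff_path_component)
  qed (simp add: homotopic_constant_maps)
  then show "homotopic_with (\<lambda>_. True) S Z f (\<lambda>_. c)"
    using b homotopic_with_trans by blast
qed blast

lemma relative_cat_nullhomotopic:
  assumes "path_connected_space Z" "Y \<subseteq> topspace Z" "c \<in> topspace Z"
  shows "relative_cat Z Y c =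
     Inf {enat r | r. r > 0 \<and>
       (\<exists>U :: nat \<Rightarrow> 'a set.
          (\<forall>i\<in>{1..r}. openin (subtopology Z Y) (U i)) \<and>
          (\<Union>i\<in>{1..r}. U i) = Y \<and>
          (\<forall>i\<in>{1..r}. \<exists>b. homotopic_with (\<lambda>_. True)
             (subtopology (subtopology Z Y) (U i)) Z (\<lambda>z. z) (\<lambda>_. b)))}"
  unfolding relative_cat_def homotopic_distance_def
    homotopic_with_const_iff_nullhomotopic[OF assms(1,3)]
  using assms(2) by (simp add: inf_absorb2)

end

theory Submission
  imports Defs
begin

text \<open>
  Composing a null-homotopy of the inclusion of a set into \<open>X \<times> X\<close> with the two projections
  deforms \<open>p\<^sub>1\<close> and \<open>p\<^sub>2\<close> to constant maps, which are homotopic since \<open>X\<close> is path-connected. Hence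
  every categorical cover is also a cover for the homotopic distance of the projections.
\<close>

text \<open>With the domain \<open>A\<close> fixed, each cover admissible for \<open>f\<close>,
  \<open>g\<close> is admissible for \<open>f'\<close>, \<open>g'\<close>. The infimum on the left
  thus runs over a larger set of numbers. The targets \<open>B\<close> and \<open>B'\<close> may
  differ, as they do for \<open>X\<close> and its square.\<close>

lemma homotopic_distance_mono:
  fixes A :: "'a topology"
  assumes "\<And>U. openin A U \<Longrightarrow> homotopic_with (\<lambda>_. True) (subtopology A U) B f g \<Longrightarrow>
      homotopic_with (\<lambda>_. True) (subtopology A U) B' f' g'"
  shows "homotopic_distance A B' f' g' \<le> homotopic_distance A B f g"
  unfolding homotopic_distance_def
proof (rule Inf_superset_mono, rule subsetI, elim CollectE exE conjE)
  fix x r U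
  assume "x = enat r" "0 < r" "(\<Union>i\<in>{1..r}. U i) = topspace A"
    and U: "\<forall>i\<in>{1..r}. openin A (U i)"
      "\<forall>i\<in>{1..r}. homotopic_with (\<lambda>_. True) (subtopology A (U i)) B f g"
  moreover have "\<forall>i\<in>{1..r}. homotopic_with (\<lambda>_. True) (subtopology A (U i)) B' f' g'"
    by (intro ballI assms U[rule_format])
  ultimately show "x \<in> {enat r | r. r > 0 \<and>
       (\<exists>U :: nat \<Rightarrow> 'a set.
          (\<forall>i\<in>{1..r}. openin A (U i)) \<and>
          (\<Union>i\<in>{1..r}. U i) = topspace A \<and>
          (\<forall>i\<in>{1..r}. homotopic_with (\<lambda>_. True) (subtopology A (U i)) B' f' g'))}"
    by (intro CollectI exI[of _ r] exI[of _ U] conjI)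
qed

lemma homotopic_fst_snd_if_homotopic_const:
  assumes X: "path_connected_space X"
    and h: "homotopic_with (\<lambda>_. True) S (prod_topology X X) (\<lambda>z. z) (\<lambda>_. c)"
  shows "homotopic_with (\<lambda>_. True) S X fst snd"
proof -
  have "homotopic_with (\<lambda>_. True) S X (p \<circ> (\<lambda>z. z)) (p \<circ> (\<lambda>_. c))"
    if "continuous_map (prod_topology X X) X p" for p
    using homotopic_with_compose_continuous_map_left[OF h that] by simp
  from this[OF continuous_map_fst] this[OF continuous_map_snd]
  have fst: "homotopic_with (\<lambda>_. True) S X fst (\<lambda>_. fst c)"
    and snd: "homotopic_with (\<lambda>_. True) S X snd (\<lambda>_. snd c)"
    by (simp_all add: o_def)
  have "homotopic_with (\<lambda>_. True) S X (\<lambda>_. fst c) (\<lambda>_. snd c)"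
  \<comment> \<open>A nonempty \<open>S\<close> forces both coordinates of \<open>c\<close> into
    \<open>X\<close>, where a path joins them. On the empty space all maps are homotopic, wherever
    \<open>c\<close> lies.\<close>
  proof (cases "S = trivial_topology")
    case False
    then have "fst c \<in> topspace X" "snd c \<in> topspace X"
      using homotopic_with_imp_continuous_maps[OF fst] homotopic_with_imp_continuous_maps[OF snd]
      by simp_all
    then show ?thesis
      using X by (simp add: homotopic_constant_maps path_connected_space_iff_path_component)
  qed (simp add: homotopic_constant_maps)
  then have "homotopic_with (\<lambda>_. True) S X fst (\<lambda>_. snd c)"
    by (rule homotopic_with_trans[OF fst])
  then show ?thesis
    by (rule homotopic_with_trans[OF _ homotopic_with_symD[OF snd]])
qed

text \<open>Continuity of the constant map says that \<open>c\<close> is a point of the square of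
  \<open>X\<close>, but leaves \<open>c\<close> arbitrary when \<open>Y\<close> is empty, so that an
  empty \<open>X\<close> is covered too.\<close>

theorem theorem3p8:
  fixes X :: "'a topology" and Y :: "('a \<times> 'a) set" and c :: "'a \<times> 'a"
  assumes "path_connected_space X"
    and "Y \<subseteq> topspace (prod_topology X X)"
    and "continuous_map (subtopology (prod_topology X X) Y) (prod_topology X X) (\<lambda>_. c)"
  shows "relative_TC2 X Y \<le> relative_cat (prod_topology X X) Y c"
  unfolding relative_TC2_def relative_cat_def
  \<comment> \<open>Here \<open>S\<close> becomes the subspace of \<open>Y\<close> carried by one
    member of a categorical cover.\<close>
  by (intro homotopic_distance_mono homotopic_fst_snd_if_homotopic_const assms(1))

end
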